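(* Let $N:k\to l$ be a net with boundaries together with a pure decomposition $N\cong N_l;N_r$, where $N_l:k\to n$ and $N_r:n\to l$ have place sets $P_l$ and $P_r$ respectively, so that (identifying places of $N_l$ and $N_r$ with places of $N$ via a fixed isomorphism) $(P_l,P_r)$ is an oriented partition of $N$. Then the vector $\left(\mathsf{bconn}_{N_r}(i)\right)_{i<n}$ is a basis for $\mathsf{network}_{P_r}(P_l)$, and the vector $\left(\mathsf{bconn}_{N_l}(i)\right)_{i<n}$ is a basis for $\mathsf{network}_{P_l}(P_r)$.
   Context: For $n\in\mathbb{N}$ let $[n]=\{0,\dots,n-1\}$; $2^X$ is the powerset of $X$; $X+Y=\{(x,0)\mid x\in X\}\cup\{(y,1)\mid y\in Y\}$. Net with boundaries. A net with boundaries $N:k\to l$ ($k,l\in\mathbb{N}$) consists of a set $P=\mathsf{places}(N)$ of places, a set $T=\mathsf{trans}(N)$ of transitions, maps ${}^\circ(-),(-)^\circ:T\to 2^P$ (pre- and post-sets), maps ${}^\bullet(-):T\to 2^{[k]}$ and $(-)^\bullet:T\to 2^{[l]}$ (connections to the left and right boundary), and a contention relation $\bowtie$ on $T$, i.e. a reflexive symmetric relation such that $t\bowtie u$ whenever at least one of ${}^\circ t\cap{}^\circ u$, $t^\circ\cap u^\circ$, ${}^\bullet t\cap{}^\bullet u$, $t^\bullet\cap u^\bullet$ is non-empty. Isomorphism $\cong$ of nets with the same boundaries is given by bijections of places and of transitions respecting pre- and post-sets, boundary connections and contention. Composition. A set $U$ of transitions is mutually independent if for all $u,v\in U$, $u\bowtie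 v$ implies $u=v$. For sets of transitions write ${}^\circ U=\bigcup_{u\in U}{}^\circ u$ and similarly for $U^\circ,{}^\bullet U,U^\bullet$, and $U\bowtie V$ iff $u\bowtie v$ for some $u\in U,v\in V$. A synchronisation between $M:l\to m$ and $N:m\to n$ is a pair $(U,V)$ of mutually independent sets $U\subseteq\mathsf{trans}(M)$, $V\subseteq\mathsf{trans}(N)$ with $U^\bullet={}^\bullet V$. It is trivial if it is $(\varnothing,\varnothing)$, and minimal if it is non-trivial and every synchronisation $(U',V')$ with $U'\subseteq U$, $V'\subseteq V$ is trivial or equal to $(U,V)$. The net $M;N:l\to n$ has places $\mathsf{places}(M)+\mathsf{places}(N)$; transitions the minimal synchronisations; ${}^\circ(U,V)={}^\circ U+{}^\circ V$, $(U,V)^\circ=U^\circ+V^\circ$, ${}^\bullet(U,V)={}^\bullet U$, $(U,V)^\bullet=V^\bullet$; and $(U,V)\bowtie(U',V')$ iff $U\bowtie U'$ or $V\bowtie V'$. Ports. Let $N:k\to l$ be a net with boundaries. Each place $p$ has two ports $p_\blacktriangleleft=(p,\mathit{in})$ and $p_\blacktriangleright=(p,\mathit{out})$; for a set $Q$ of places, $\mathsf{ports}(Q)=\{p_\blacktriangleleft\mid p\in Q\}\cup\{p_\blacktriangleright\mid p\in Q\}$. The boundary ports are the elements of $[k]+[l]$, written $i_{\mathsf L}=(i,0)$ (left, $i<k$) and $i_{\mathsf R}=(i,1)$ (right, $i<l$). $\mathsf{ports}(N)=\mathsf{ports}(\mathsf{places}(N))\cup([k]+[l])$. For a transition $t$,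 $\mathsf{ports}(t)=\{p_\blacktriangleright\mid p\in{}^\circ t\}\cup\{p_\blacktriangleleft\mid p\in t^\circ\}\cup({}^\bullet t+t^\bullet)$. A portset is a set of ports, a connection is a set of portsets, and a network is a set of connections. For a port $p$ of $N$, $$\mathsf{conn}(p)=\mathsf{conn}^N(p)=\{\mathsf{ports}(t)\setminus\{p\}\mid t\in\mathsf{trans}(N),\ \{p\}\subsetneq\mathsf{ports}(t)\},$$ and for a set $R$ of ports, $\mathsf{conn}_R(p)=\{K\cap R\mid K\in\mathsf{conn}(p),\ K\cap R\neq\varnothing\}$. Oriented partitions and networks. An oriented partition of $N:k\to l$ is a pair $(P_l,P_r)$ of non-empty sets such that $\{P_l,P_r\}$ is a partition of $\mathsf{places}(N)$. Its extended ports are $\mathsf{eports}(P_l)=\mathsf{ports}(P_l)\cup\{i_{\mathsf L}\mid i<k\}$ and $\mathsf{eports}(P_r)=\mathsf{ports}(P_r)\cup\{i_{\mathsf R}\mid i<l\}$. Define $\mathsf{network}_{P_r}(P_l)=\{\mathsf{conn}_{\mathsf{eports}(P_r)}(p)\mid p\in\mathsf{eports}(P_l)\}$ and $\mathsf{network}_{P_l}(P_r)=\{\mathsf{conn}_{\mathsf{eports}(P_l)}(p)\mid p\in\mathsf{eports}(P_r)\}$, computed in $N$. Basis. A vector of connections $b_0,\dots,b_{n-1}$ is a basis of a network $W$ if for every $c\in W$ there is $I\subseteq[n]$ with $c=\bigcup_{i\in I}b_i$. Pure decompositions. Let $N\cong N_l;N_r$ with $N_l:k\to n$, $N_r:n\to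 l$. For each shared-boundary port $j<n$ put $\mathsf{bconn}_{N_l}(j)=\mathsf{conn}^{N_l}(j_{\mathsf R})$ and $\mathsf{bconn}_{N_r}(j)=\mathsf{conn}^{N_r}(j_{\mathsf L})$. The decomposition is pure if for all $j<n$ no portset in $\mathsf{bconn}_{N_l}(j)$ contains a right boundary port $i_{\mathsf R}$ of $N_l$, and no portset in $\mathsf{bconn}_{N_r}(j)$ contains a left boundary port $i_{\mathsf L}$ of $N_r$; i.e. no transition of $N_l$ or $N_r$ connects to two different shared-boundary ports. For a pure decomposition, the portsets in $\mathsf{bconn}_{N_l}(j)$ and $\mathsf{bconn}_{N_r}(j)$ are regarded as sets of ports of $N$ (place ports via the fixed isomorphism; the left boundary ports of $N_l$ and the right boundary ports of $N_r$ are those of $N$). *)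

theory Defs
  imports Main
begin

section \<open>Nets with boundaries\<close>

text \<open>
  The fields \<open>lsize\<close> and \<open>rsize\<close> are the numbers \<open>k\<close> and \<open>l\<close> of a net \<open>N : k \<rightarrow> l\<close>.
  The maps on transitions are total functions; only their values on \<open>transitions N\<close> matter.
\<close>

record ('p, 't) net =
  lsize :: nat
  rsize :: nat
  places :: "'p set"
  transitions :: "'t set"
  preset :: "'t \<Rightarrow> 'p set"
  postset :: "'t \<Rightarrow> 'p set"
  lconn :: "'t \<Rightarrow> nat set"
  rconn :: "'t \<Rightarrow> nat set"
  contention :: "('t \<times> 't) set"

definition boundary_net :: "nat \<Rightarrow> nat \<Rightarrow> ('p, 't) net \<Rightarrow> bool" where
  "boundary_net k l N \<longleftrightarrow>
     lsize N = k \<and> rsize N = l \<and>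
     (\<forall>t \<in> transitions N. preset N t \<subseteq> places N \<and> postset N t \<subseteq> places N \<and>
        lconn N t \<subseteq> {..<k} \<and> rconn N t \<subseteq> {..<l}) \<and>
     contention N \<subseteq> transitions N \<times> transitions N \<and>
     refl_on (transitions N) (contention N) \<and>
     sym (contention N) \<and>
     (\<forall>t \<in> transitions N. \<forall>u \<in> transitions N.
        preset N t \<inter> preset N u \<noteq> {} \<or> postset N t \<inter> postset N u \<noteq> {} \<or>
        lconn N t \<inter> lconn N u \<noteq> {} \<or> rconn N t \<inter> rconn N u \<noteq> {}
        \<longrightarrow> (t, u) \<in> contention N)"

text \<open>The pair \<open>f\<close>, \<open>g\<close> is an isomorphism from \<open>M\<close> to \<open>N\<close>.\<close>

definition net_iso ::
    "('p \<Rightarrow> 'q) \<Rightarrow> ('t \<Rightarrow> 'u) \<Rightarrow> ('p, 't) net \<Rightarrow> ('q, 'u) net \<Rightarrow> bool" where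
  "net_iso f g M N \<longleftrightarrow>
     lsize N = lsize M \<and> rsize N = rsize M \<and>
     bij_betw f (places M) (places N) \<and>
     bij_betw g (transitions M) (transitions N) \<and>
     (\<forall>t \<in> transitions M.
        preset N (g t) = f ` preset M t \<and> postset N (g t) = f ` postset M t \<and>
        lconn N (g t) = lconn M t \<and> rconn N (g t) = rconn M t) \<and>
     (\<forall>t \<in> transitions M. \<forall>u \<in> transitions M.
        (g t, g u) \<in> contention N \<longleftrightarrow> (t, u) \<in> contention M)"

section \<open>Composition\<close>

definition mutually_independent :: "('p, 't) net \<Rightarrow> 't set \<Rightarrow> bool" where
  "mutually_independent N U \<longleftrightarrow> (\<forall>u \<in> U. \<forall>v \<in> U. (u, v) \<in> contention N \<longrightarrow> u = v)"

definition set_contention :: "('p, 't) net \<Rightarrow> 't set \<Rightarrow> 't set \<Rightarrow> bool" where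
  "set_contention N U V \<longleftrightarrow> (\<exists>u \<in> U. \<exists>v \<in> V. (u, v) \<in> contention N)"

definition synchronisation ::
    "('p, 't) net \<Rightarrow> ('q, 'u) net \<Rightarrow> 't set \<Rightarrow> 'u set \<Rightarrow> bool" where
  "synchronisation M N U V \<longleftrightarrow>
     U \<subseteq> transitions M \<and> V \<subseteq> transitions N \<and>
     mutually_independent M U \<and> mutually_independent N V \<and>
     \<Union> (rconn M ` U) = \<Union> (lconn N ` V)"

definition minimal_synchronisation ::
    "('p, 't) net \<Rightarrow> ('q, 'u) net \<Rightarrow> 't set \<Rightarrow> 'u set \<Rightarrow> bool" where
  "minimal_synchronisation M N U V \<longleftrightarrow>
     synchronisation M N U V \<and> (U, V) \<noteq> ({}, {}) \<and>
     (\<forall>U' V'. synchronisation M N U' V' \<and> U' \<subseteq> U \<and> V' \<subseteq> V \<longrightarrow>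
        (U', V') = ({}, {}) \<or> (U', V') = (U, V))"

text \<open>The composite \<open>M;N\<close>, meaningful when \<open>rsize M = lsize N\<close>.\<close>

definition compose ::
    "('p, 't) net \<Rightarrow> ('q, 'u) net \<Rightarrow> ('p + 'q, 't set \<times> 'u set) net" where
  "compose M N =
     \<lparr> lsize = lsize M,
       rsize = rsize N,
       places = places M <+> places N,
       transitions = {(U, V). minimal_synchronisation M N U V},
       preset = (\<lambda>(U, V). \<Union> (preset M ` U) <+> \<Union> (preset N ` V)),
       postset = (\<lambda>(U, V). \<Union> (postset M ` U) <+> \<Union> (postset N ` V)),
       lconn = (\<lambda>(U, V). \<Union> (lconn M ` U)),
       rconn = (\<lambda>(U, V). \<Union> (rconn N ` V)),
       contention = {((U, V), (U', V')).
         minimal_synchronisation M N U V \<and> minimal_synchronisation M N U' V' \<and>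
         (set_contention M U U' \<or> set_contention N V V')} \<rparr>"

lemma boundary_net_compose:
  assumes "boundary_net l m M" and "boundary_net m n N"
  shows "boundary_net l n (compose M N)"
proof -
  let ?C = "compose M N"
  note M = assms(1)[unfolded boundary_net_def] and N = assms(2)[unfolded boundary_net_def]
  have rM: "\<forall>t \<in> transitions M. (t, t) \<in> contention M"
    and rN: "\<forall>t \<in> transitions N. (t, t) \<in> contention N"
    and sM: "sym (contention M)" and sN: "sym (contention N)"
    and bM: "\<forall>t \<in> transitions M. preset M t \<subseteq> places M \<and> postset M t \<subseteq> places M \<and> lconn M t \<subseteq> {..<l}"
    and bN: "\<forall>t \<in> transitions N. preset N t \<subseteq> places N \<and> postset N t \<subseteq> places N \<and> rconn N t \<subseteq> {..<n}"
    using M N by (simp_all add: refl_on_def)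
  have sub: "U \<subseteq> transitions M \<and> V \<subseteq> transitions N \<and> (U \<noteq> {} \<or> V \<noteq> {})"
    if "minimal_synchronisation M N U V" for U V
    using that by (auto simp: minimal_synchronisation_def synchronisation_def)
  have symM: "set_contention M V U" if "set_contention M U V" for U V
    using that sM unfolding set_contention_def sym_def by blast
  have symN: "set_contention N V U" if "set_contention N U V" for U V
    using that sN unfolding set_contention_def sym_def by blast
  have 1: "lsize ?C = l" "rsize ?C = n" using M N by (auto simp: compose_def)
  have 2: "\<forall>t \<in> transitions ?C. preset ?C t \<subseteq> places ?C \<and> postset ?C t \<subseteq> places ?C \<and>
        lconn ?C t \<subseteq> {..<l} \<and> rconn ?C t \<subseteq> {..<n}"
  proof
    fix t assume "t \<in> transitions ?C"
    then obtain U V where t: "t = (U, V)" and "minimal_synchronisation M N U V"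
      by (auto simp: compose_def)
    then have "U \<subseteq> transitions M" "V \<subseteq> transitions N" using sub by blast+
    then show "preset ?C t \<subseteq> places ?C \<and> postset ?C t \<subseteq> places ?C \<and>
        lconn ?C t \<subseteq> {..<l} \<and> rconn ?C t \<subseteq> {..<n}"
      using bM bN unfolding t by (simp add: compose_def) blast
  qed
  have 3: "contention ?C \<subseteq> transitions ?C \<times> transitions ?C" by (auto simp: compose_def)
  have 4: "refl_on (transitions ?C) (contention ?C)"
  proof -
    have "set_contention M U U \<or> set_contention N V V" if "minimal_synchronisation M N U V" for U V
      using sub[OF that] rM rN unfolding set_contention_def by blast
    then show ?thesis by (auto simp: compose_def refl_on_def)
  qed
  have 5: "sym (contention ?C)" 
    by (auto simp: compose_def sym_def symM symN)
  have cM: "set_contention M U U'" if "t \<in> U" "u \<in> U'" "U \<subseteq> transitions M" "U' \<subseteq> transitions M"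
    "preset M t \<inter> preset M u \<noteq> {} \<or> postset M t \<inter> postset M u \<noteq> {} \<or>
     lconn M t \<inter> lconn M u \<noteq> {} \<or> rconn M t \<inter> rconn M u \<noteq> {}" for t u U U'
    using that M unfolding set_contention_def by (meson subsetD)
  have cN: "set_contention N U U'" if "t \<in> U" "u \<in> U'" "U \<subseteq> transitions N" "U' \<subseteq> transitions N"
    "preset N t \<inter> preset N u \<noteq> {} \<or> postset N t \<inter> postset N u \<noteq> {} \<or>
     lconn N t \<inter> lconn N u \<noteq> {} \<or> rconn N t \<inter> rconn N u \<noteq> {}" for t u U U'
    using that N unfolding set_contention_def by (meson subsetD)
  have 6: "(t, u) \<in> contention ?C" if tu: "t \<in> transitions ?C" "u \<in> transitions ?C" and
    ne: "preset ?C t \<inter> preset ?C u \<noteq> {} \<or> postset ?C t \<inter> postset ?C u \<noteq> {} \<or>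
        lconn ?C t \<inter> lconn ?C u \<noteq> {} \<or> rconn ?C t \<inter> rconn ?C u \<noteq> {}" for t u
  proof -
    obtain U V U' V' where [simp]: "t = (U, V)" "u = (U', V')" by (metis surj_pair)
    have m: "minimal_synchronisation M N U V" "minimal_synchronisation M N U' V'"
      using tu by (auto simp: compose_def)
    note s = sub[OF m(1)] sub[OF m(2)]
    have "set_contention M U U' \<or> set_contention N V V'"
    proof -
      have "(\<exists>t\<in>U. \<exists>u\<in>U'. preset M t \<inter> preset M u \<noteq> {} \<or> postset M t \<inter> postset M u \<noteq> {} \<or>
          lconn M t \<inter> lconn M u \<noteq> {} \<or> rconn M t \<inter> rconn M u \<noteq> {}) \<or>
        (\<exists>t\<in>V. \<exists>u\<in>V'. preset N t \<inter> preset N u \<noteq> {} \<or> postset N t \<inter> postset N u \<noteq> {} \<or>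
          lconn N t \<inter> lconn N u \<noteq> {} \<or> rconn N t \<inter> rconn N u \<noteq> {})"
        using ne by (simp add: compose_def) blast
      then show ?thesis using cM cN s by meson
    qed
    then show ?thesis using m by (simp add: compose_def)
  qed
  show ?thesis unfolding boundary_net_def by (intro conjI ballI impI 1 3 4 5 6; use 2 in blast)
qed

section \<open>Ports\<close>

text \<open>
  \<open>In p\<close> and \<open>Out p\<close> are the two ports of a place \<open>p\<close>; \<open>LeftB i\<close> and \<open>RightB i\<close> are the
  boundary ports.  The functorial action \<open>map_port f\<close> of the datatype renames places by \<open>f\<close>
  and leaves boundary ports unchanged.
\<close>

datatype 'p port = In 'p | Out 'p | LeftB nat | RightB nat

definition place_ports :: "'p set \<Rightarrow> 'p port set" where
  "place_ports Q = In ` Q \<union> Out ` Q"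

definition trans_ports :: "('p, 't) net \<Rightarrow> 't \<Rightarrow> 'p port set" where
  "trans_ports N t =
     Out ` preset N t \<union> In ` postset N t \<union> LeftB ` lconn N t \<union> RightB ` rconn N t"

definition conn :: "('p, 't) net \<Rightarrow> 'p port \<Rightarrow> 'p port set set" where
  "conn N p = {trans_ports N t - {p} | t. t \<in> transitions N \<and> {p} \<subset> trans_ports N t}"

definition conn_on :: "('p, 't) net \<Rightarrow> 'p port set \<Rightarrow> 'p port \<Rightarrow> 'p port set set" where
  "conn_on N R p = {K \<inter> R | K. K \<in> conn N p \<and> K \<inter> R \<noteq> {}}"

section \<open>Oriented partitions and networks\<close>

definition oriented_partition :: "('p, 't) net \<Rightarrow> 'p set \<Rightarrow> 'p set \<Rightarrow> bool" where
  "oriented_partition N Pl Pr \<longleftrightarrow>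
     Pl \<noteq> {} \<and> Pr \<noteq> {} \<and> Pl \<inter> Pr = {} \<and> Pl \<union> Pr = places N"

definition eports_left :: "('p, 't) net \<Rightarrow> 'p set \<Rightarrow> 'p port set" where
  "eports_left N Pl = place_ports Pl \<union> LeftB ` {..<lsize N}"

definition eports_right :: "('p, 't) net \<Rightarrow> 'p set \<Rightarrow> 'p port set" where
  "eports_right N Pr = place_ports Pr \<union> RightB ` {..<rsize N}"

text \<open>
  For an oriented partition \<open>(Pl, Pr)\<close>, \<open>network_left N Pl Pr\<close> is the network of the left
  part \<open>Pl\<close> relative to \<open>Pr\<close>, and \<open>network_right N Pl Pr\<close> that of the right part \<open>Pr\<close>
  relative to \<open>Pl\<close>.
\<close>

definition network_left :: "('p, 't) net \<Rightarrow> 'p set \<Rightarrow> 'p set \<Rightarrow> 'p port set set set" where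
  "network_left N Pl Pr = conn_on N (eports_right N Pr) ` eports_left N Pl"

definition network_right :: "('p, 't) net \<Rightarrow> 'p set \<Rightarrow> 'p set \<Rightarrow> 'p port set set set" where
  "network_right N Pl Pr = conn_on N (eports_left N Pl) ` eports_right N Pr"

text \<open>A vector of length \<open>n\<close> is a function on \<open>nat\<close> of which only the values below \<open>n\<close> matter.\<close>

definition is_basis ::
    "nat \<Rightarrow> (nat \<Rightarrow> 'p port set set) \<Rightarrow> 'p port set set set \<Rightarrow> bool" where
  "is_basis n b W \<longleftrightarrow> (\<forall>c \<in> W. \<exists>I \<subseteq> {..<n}. c = (\<Union>i \<in> I. b i))"

section \<open>Pure decompositions\<close>

text \<open>
  The shared boundary is the right boundary of the left factor (\<open>bconn_left\<close>) and the left
  boundary of the right factor (\<open>bconn_right\<close>).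
\<close>

definition bconn_left :: "('p, 't) net \<Rightarrow> nat \<Rightarrow> 'p port set set" where
  "bconn_left Nl j = conn Nl (RightB j)"

definition bconn_right :: "('p, 't) net \<Rightarrow> nat \<Rightarrow> 'p port set set" where
  "bconn_right Nr j = conn Nr (LeftB j)"

definition pure_decomposition ::
    "nat \<Rightarrow> ('p, 't) net \<Rightarrow> ('q, 'u) net \<Rightarrow> bool" where
  "pure_decomposition n Nl Nr \<longleftrightarrow>
     (\<forall>j < n. (\<forall>K \<in> bconn_left Nl j. \<forall>i < n. RightB i \<notin> K) \<and>
              (\<forall>K \<in> bconn_right Nr j. \<forall>i < n. LeftB i \<notin> K))"

end

theory Submission
  imports Defs
begin

text \<open>
  Purity says that every transition of a factor meets the shared boundary in at most one port.
  Hence a minimal synchronisation consists of a single transition not touching the shared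
  boundary, or of two transitions \<open>u\<close>, \<open>v\<close> meeting it in the same port \<open>j\<close>, and every such
  configuration is a minimal synchronisation.  A port \<open>p\<close> on one side therefore
  sees, on the other side, exactly the ports of all \<open>v\<close> connected to one of the shared ports
  \<open>j\<close> to which some transition containing \<open>p\<close> connects; these \<open>j\<close> form the index set.
\<close>

section \<open>Ports of a factor's transition away from the shared boundary\<close>

text \<open>Omits \<open>rconn\<close>, because the shared boundary is the right boundary of the
  left factor. After renaming of places these are the ports that the transition contributes to a
  composite transition. Dually, \<open>right_ports\<close> omits \<open>lconn\<close>.\<close>

definition left_ports :: "('p, 't) net \<Rightarrow> 't \<Rightarrow> 'p port set" where
  "left_ports N t = Out ` preset N t \<union> In ` postset N t \<union> LeftB ` lconn N t"

definition right_ports :: "('p, 't) net \<Rightarrow> 't \<Rightarrow> 'p port set" where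
  "right_ports N t = Out ` preset N t \<union> In ` postset N t \<union> RightB ` rconn N t"

text \<open>If \<open>u\<close> had two shared ports, deleting \<open>RightB j\<close> from its
  ports would leave \<open>RightB i\<close> in a portset of \<open>bconn_left Nl j\<close>, which
  purity forbids. Purity speaks only of ports below \<open>n\<close>; the boundary typing supplies
  these bounds.\<close>

lemma pure_decomposition_rconn_unique:
  assumes "boundary_net k n Nl" "pure_decomposition n Nl Nr"
    and "u \<in> transitions Nl" "i \<in> rconn Nl u" "j \<in> rconn Nl u"
  shows "i = j"
proof (rule ccontr)
  assume "i \<noteq> j"
  have lt: "i < n" "j < n" using assms(1,3-5) unfolding boundary_net_def by blast+
  have p: "RightB i \<in> trans_ports Nl u" "RightB j \<in> trans_ports Nl u"
    using assms(4,5) by (auto simp: trans_ports_def)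
  then have "{RightB j} \<subset> trans_ports Nl u" using \<open>i \<noteq> j\<close> by auto
  then have "trans_ports Nl u - {RightB j} \<in> bconn_left Nl j"
    using assms(3) unfolding bconn_left_def conn_def by blast
  moreover have "RightB i \<in> trans_ports Nl u - {RightB j}" using p \<open>i \<noteq> j\<close> by auto
  ultimately show False using assms(2) lt unfolding pure_decomposition_def by metis
qed

lemma pure_decomposition_lconn_unique:
  assumes "boundary_net n l Nr" "pure_decomposition n Nl Nr"
    and "v \<in> transitions Nr" "i \<in> lconn Nr v" "j \<in> lconn Nr v"
  shows "i = j"
proof (rule ccontr)
  assume "i \<noteq> j"
  have lt: "i < n" "j < n" using assms(1,3-5) unfolding boundary_net_def by blast+
  have p: "LeftB i \<in> trans_ports Nr v" "LeftB j \<in> trans_ports Nr v"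
    using assms(4,5) by (auto simp: trans_ports_def)
  then have "{LeftB j} \<subset> trans_ports Nr v" using \<open>i \<noteq> j\<close> by auto
  then have "trans_ports Nr v - {LeftB j} \<in> bconn_right Nr j"
    using assms(3) unfolding bconn_right_def conn_def by blast
  moreover have "LeftB i \<in> trans_ports Nr v - {LeftB j}" using p \<open>i \<noteq> j\<close> by auto
  ultimately show False using assms(2) lt unfolding pure_decomposition_def by metis
qed

text \<open>Since \<open>RightB j\<close> is the only shared port of such a \<open>u\<close>,
  deleting it leaves exactly \<open>left_ports Nl u\<close>. The strict inclusion in
  \<open>conn\<close> turns into non-emptiness of this remainder.\<close>

lemma bconn_left_eq:
  assumes "\<And>u i j. u \<in> transitions Nl \<Longrightarrow> i \<in> rconn Nl u \<Longrightarrow> j \<in> rconn Nl u \<Longrightarrow> i = j"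
  shows "bconn_left Nl j =
    {left_ports Nl u | u. u \<in> transitions Nl \<and> j \<in> rconn Nl u \<and> left_ports Nl u \<noteq> {}}"
proof -
  have *: "trans_ports Nl u - {RightB j} = left_ports Nl u"
    if "u \<in> transitions Nl" "j \<in> rconn Nl u" for u
    using assms[OF that(1)] that(2) by (auto simp: trans_ports_def left_ports_def)
  have **: "{RightB j} \<subset> trans_ports Nl u \<longleftrightarrow>
    j \<in> rconn Nl u \<and> trans_ports Nl u - {RightB j} \<noteq> {}" for u
    by (auto simp: trans_ports_def)
  show ?thesis unfolding bconn_left_def conn_def
    by (rule Collect_cong) (metis (no_types, lifting) * **)
qed

lemma bconn_right_eq:
  assumes "\<And>v i j. v \<in> transitions Nr \<Longrightarrow> i \<in> lconn Nr v \<Longrightarrow> j \<in> lconn Nr v \<Longrightarrow> i = j"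
  shows "bconn_right Nr j =
    {right_ports Nr v | v. v \<in> transitions Nr \<and> j \<in> lconn Nr v \<and> right_ports Nr v \<noteq> {}}"
proof -
  have *: "trans_ports Nr v - {LeftB j} = right_ports Nr v"
    if "v \<in> transitions Nr" "j \<in> lconn Nr v" for v
    using assms[OF that(1)] that(2) by (auto simp: trans_ports_def right_ports_def)
  have **: "{LeftB j} \<subset> trans_ports Nr v \<longleftrightarrow>
    j \<in> lconn Nr v \<and> trans_ports Nr v - {LeftB j} \<noteq> {}" for v
    by (auto simp: trans_ports_def)
  show ?thesis unfolding bconn_right_def conn_def
    by (rule Collect_cong) (metis (no_types, lifting) * **)
qed

section \<open>Minimal synchronisations under purity\<close>

text \<open>Singletons are mutually independent. A smaller pair with exactly one empty component
  would have boundary \<open>{j}\<close> on one side and \<open>{}\<close> on the other.\<close>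

lemma minimal_synchronisation_pair:
  assumes "u \<in> transitions M" "v \<in> transitions N" "rconn M u = {j}" "lconn N v = {j}"
  shows "minimal_synchronisation M N {u} {v}"
proof -
  have "(U', V') = ({}, {}) \<or> (U', V') = ({u}, {v})"
    if "\<Union> (rconn M ` U') = \<Union> (lconn N ` V')" "U' \<subseteq> {u}" "V' \<subseteq> {v}" for U' V'
    using that assms(3,4) by (auto simp: subset_singleton_iff)
  then show ?thesis
    using assms unfolding minimal_synchronisation_def synchronisation_def mutually_independent_def
    by simp
qed

text \<open>Pick \<open>u\<close> in \<open>U\<close>, a shared port \<open>j\<close> of
  \<open>u\<close>, and \<open>v\<close> in \<open>V\<close> matching \<open>j\<close>. By
  uniqueness of shared ports \<open>({u}, {v})\<close> is already a synchronisation, so minimality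
  makes it all of \<open>(U, V)\<close>.\<close>

lemma minimal_synchronisation_cases:
  assumes uM: "\<And>u i j. u \<in> transitions M \<Longrightarrow> i \<in> rconn M u \<Longrightarrow> j \<in> rconn M u \<Longrightarrow> i = j"
    and uN: "\<And>v i j. v \<in> transitions N \<Longrightarrow> i \<in> lconn N v \<Longrightarrow> j \<in> lconn N v \<Longrightarrow> i = j"
    and min: "minimal_synchronisation M N U V" and "U \<noteq> {}" "V \<noteq> {}"
  obtains u v j where "U = {u}" "V = {v}" "u \<in> transitions M" "v \<in> transitions N"
    "rconn M u = {j}" "lconn N v = {j}"
proof -
  have sub: "U \<subseteq> transitions M" "V \<subseteq> transitions N"
    and bd: "\<Union> (rconn M ` U) = \<Union> (lconn N ` V)"
    using min by (auto simp: minimal_synchronisation_def synchronisation_def)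
  have min': "(U', V') = ({}, {}) \<or> (U', V') = (U, V)"
    if "synchronisation M N U' V'" "U' \<subseteq> U" "V' \<subseteq> V" for U' V'
    using min that unfolding minimal_synchronisation_def by blast
  obtain u where u: "u \<in> U" using \<open>U \<noteq> {}\<close> by blast
  then have uT: "u \<in> transitions M" using sub by blast
  have "rconn M u \<noteq> {}"
  proof
    assume "rconn M u = {}"
    \<comment> \<open>A transition off the shared boundary synchronises with nothing; this pair is
      non-trivial and differs from \<open>(U, V)\<close> because \<open>V\<close> is
      non-empty.\<close>
    then have "synchronisation M N {u} {}"
      using uT by (auto simp: synchronisation_def mutually_independent_def)
    from min'[OF this] u \<open>V \<noteq> {}\<close> show False by auto
  qed
  then obtain j where j: "j \<in> rconn M u" by blast
  then obtain v where v: "v \<in> V" "j \<in> lconn N v" using bd u by blast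
  then have vT: "v \<in> transitions N" using sub by blast
  have eqs: "rconn M u = {j}" "lconn N v = {j}"
    using uM[OF uT] uN[OF vT] j v(2) by blast+
  have "synchronisation M N {u} {v}"
    using minimal_synchronisation_pair[OF uT vT eqs] by (simp add: minimal_synchronisation_def)
  from min'[OF this] u v have "U = {u}" "V = {v}" by auto
  then show thesis using that uT vT eqs by blast
qed

section \<open>An abstract criterion for a basis\<close>

text \<open>Deleting \<open>p\<close> does not change the intersection with \<open>R\<close>, and
  any port in \<open>R\<close> differs from \<open>p\<close>, so strictness of the inclusion in
  \<open>conn\<close> is automatic.\<close>

lemma conn_on_eq:
  assumes "p \<notin> R"
  shows "conn_on N R p = {trans_ports N t \<inter> R | t.
    t \<in> transitions N \<and> p \<in> trans_ports N t \<and> trans_ports N t \<inter> R \<noteq> {}}"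
proof -
  have *: "(S - {p}) \<inter> R = S \<inter> R" and **: "S \<inter> R \<noteq> {} \<Longrightarrow> {p} \<subset> S \<longleftrightarrow> p \<in> S" for S
    using assms by blast+
  show ?thesis unfolding conn_on_def conn_def mem_Collect_eq
    by (rule Collect_cong) (metis (no_types, lifting) * **)
qed

text \<open>Stated symmetrically so that both halves of the theorem are instances. \<open>X\<close>
  and \<open>Y\<close> stand for the transitions of the near and the far factor, \<alpha> and
  \<beta> for their shared ports, \<open>L\<close> and \<open>R\<close> for their renamed other
  ports.\<close>

lemma is_basis_conn_on:
  assumes "A \<inter> B = {}"
    and cross: "\<And>t. t \<in> transitions N \<Longrightarrow> trans_ports N t \<inter> A \<noteq> {} \<Longrightarrow> trans_ports N t \<inter> B \<noteq> {} \<Longrightarrow>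
      \<exists>u \<in> X. \<exists>v \<in> Y. \<exists>j. j \<in> \<alpha> u \<and> j \<in> \<beta> v \<and> trans_ports N t \<inter> A = L u \<and> trans_ports N t \<inter> B = R v"
    and pair: "\<And>u v j. u \<in> X \<Longrightarrow> v \<in> Y \<Longrightarrow> j \<in> \<alpha> u \<Longrightarrow> j \<in> \<beta> v \<Longrightarrow>
      \<exists>t \<in> transitions N. trans_ports N t \<inter> A = L u \<and> trans_ports N t \<inter> B = R v"
    and bound: "\<And>u. u \<in> X \<Longrightarrow> \<alpha> u \<subseteq> {..<n}"
  shows "is_basis n (\<lambda>j. {R v | v. v \<in> Y \<and> j \<in> \<beta> v \<and> R v \<noteq> {}}) (conn_on N B ` A)"
  unfolding is_basis_def
proof (intro ballI, elim imageE)
  fix c p assume c: "c = conn_on N B p" and p: "p \<in> A"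
  then have "p \<notin> B" using \<open>A \<inter> B = {}\<close> by blast
  \<comment> \<open>The shared ports reached by near-side transitions that contain
    \<open>p\<close>.\<close>
  let ?I = "{j. \<exists>u \<in> X. j \<in> \<alpha> u \<and> p \<in> L u}"
  have "c = (\<Union>j\<in>?I. {R v | v. v \<in> Y \<and> j \<in> \<beta> v \<and> R v \<noteq> {}})"
    unfolding c conn_on_eq[OF \<open>p \<notin> B\<close>]
  proof (intro equalityI subsetI)
    fix K assume "K \<in> {trans_ports N t \<inter> B | t.
      t \<in> transitions N \<and> p \<in> trans_ports N t \<and> trans_ports N t \<inter> B \<noteq> {}}"
    then obtain t where t: "K = trans_ports N t \<inter> B" "t \<in> transitions N"
      "p \<in> trans_ports N t \<inter> A" "trans_ports N t \<inter> B \<noteq> {}" using p by blast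
    have "trans_ports N t \<inter> A \<noteq> {}" using t(3) by blast
    from cross[OF t(2) this t(4)] obtain u v j where "u \<in> X" "v \<in> Y" "j \<in> \<alpha> u" "j \<in> \<beta> v"
      "trans_ports N t \<inter> A = L u" "trans_ports N t \<inter> B = R v" by blast
    then have "u \<in> X" "v \<in> Y" "j \<in> \<alpha> u" "j \<in> \<beta> v" "p \<in> L u" "K = R v" "R v \<noteq> {}" using t by simp_all
    then show "K \<in> (\<Union>j\<in>?I. {R v | v. v \<in> Y \<and> j \<in> \<beta> v \<and> R v \<noteq> {}})" by blast
  next
    fix K assume "K \<in> (\<Union>j\<in>?I. {R v | v. v \<in> Y \<and> j \<in> \<beta> v \<and> R v \<noteq> {}})"
    then obtain u v j where uv: "u \<in> X" "v \<in> Y" "j \<in> \<alpha> u" "j \<in> \<beta> v"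
      and K: "p \<in> L u" "K = R v" "R v \<noteq> {}" by blast
    \<comment> \<open>The \<open>u\<close> that puts \<open>j\<close> into \<open>?I\<close>
      combines with every \<open>v\<close> at \<open>j\<close>; hence the union contains whole basis
      vectors and not just parts of them.\<close>
    obtain t where "t \<in> transitions N" "trans_ports N t \<inter> A = L u" "trans_ports N t \<inter> B = R v"
      using pair[OF uv] by blast
    then show "K \<in> {trans_ports N t \<inter> B | t.
      t \<in> transitions N \<and> p \<in> trans_ports N t \<and> trans_ports N t \<inter> B \<noteq> {}}" using K by blast
  qed
  moreover have "?I \<subseteq> {..<n}" using bound by blast
  ultimately show "\<exists>I\<subseteq>{..<n}. c = (\<Union>j\<in>I. {R v | v. v \<in> Y \<and> j \<in> \<beta> v \<and> R v \<noteq> {}})" by blast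
qed

section \<open>Renaming of ports and the ports of the composite\<close>

lemma image_left_ports:
  "map_port h ` left_ports N t = Out ` h ` preset N t \<union> In ` h ` postset N t \<union> LeftB ` lconn N t"
  by (simp add: left_ports_def image_Un image_image)

lemma image_right_ports:
  "map_port h ` right_ports N t = Out ` h ` preset N t \<union> In ` h ` postset N t \<union> RightB ` rconn N t"
  by (simp add: right_ports_def image_Un image_image)

lemma image_Plus:
  "f ` (A <+> B) = (f \<circ> Inl) ` A \<union> (f \<circ> Inr) ` B"
  by (simp add: Plus_def image_Un image_image)

lemma eports_disjoint:
  assumes "oriented_partition N Pl Pr"
  shows "eports_left N Pl \<inter> eports_right N Pr = {}"
  using assms by (auto simp: oriented_partition_def eports_left_def eports_right_def place_ports_def)

theorem proposition22:
  fixes N :: "('p, 't) net" and Nl :: "('a, 'u) net" and Nr :: "('b, 'v) net"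
    and k l n :: nat
    and f :: "'a + 'b \<Rightarrow> 'p" and g :: "'u set \<times> 'v set \<Rightarrow> 't"
    and Pl Pr :: "'p set"
  assumes "boundary_net k l N"
    and "boundary_net k n Nl"
    and "boundary_net n l Nr"
    and "net_iso f g (compose Nl Nr) N"
    and "pure_decomposition n Nl Nr"
    and "places Nl \<noteq> {}" and "places Nr \<noteq> {}"
    and "Pl = (f \<circ> Inl) ` places Nl"
    and "Pr = (f \<circ> Inr) ` places Nr"
  shows "oriented_partition N Pl Pr \<and>
    is_basis n (\<lambda>i. image (map_port (f \<circ> Inr)) ` bconn_right Nr i) (network_left N Pl Pr) \<and>
    is_basis n (\<lambda>i. image (map_port (f \<circ> Inl)) ` bconn_left Nl i) (network_right N Pl Pr)"
proof -
  let ?hl = "f \<circ> Inl" and ?hr = "f \<circ> Inr"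
  let ?L = "\<lambda>u. map_port ?hl ` left_ports Nl u" and ?R = "\<lambda>v. map_port ?hr ` right_ports Nr v"
  let ?EL = "eports_left N Pl" and ?ER = "eports_right N Pr"
  let ?T = "{(U, V). minimal_synchronisation Nl Nr U V}"
  note unl = pure_decomposition_rconn_unique[OF assms(2,5)]
  note unr = pure_decomposition_lconn_unique[OF assms(3,5)]
  note iso = assms(4)[unfolded net_iso_def]
  have size: "lsize N = k" "rsize N = l" using assms(1) by (auto simp: boundary_net_def)
  have bij: "bij_betw f (places Nl <+> places Nr) (places N)"
    using iso by (simp add: compose_def)
  have trans_N: "transitions N = g ` ?T"
    using iso by (simp add: compose_def bij_betw_def)
  have "Pl \<union> Pr = places N"
    using bij assms(8,9) by (simp add: bij_betw_def image_Plus)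
  \<comment> \<open>The two summands are disjoint and \<open>f\<close> is injective on the sum of
    the place sets.\<close>
  moreover have "Pl \<inter> Pr = {}"
    using bij unfolding assms(8,9) bij_betw_def inj_on_def by fastforce
  ultimately have part: "oriented_partition N Pl Pr"
    using assms(6-9) by (simp add: oriented_partition_def)
  note disj = eports_disjoint[OF part]
  \<comment> \<open>Once a port set is written as a union of one part per side, intersecting with a
    side reads off that part.\<close>
  have split: "(X \<union> Y) \<inter> ?EL = X \<and> (X \<union> Y) \<inter> ?ER = Y" if "X \<subseteq> ?EL" "Y \<subseteq> ?ER" for X Y
    using disj that by blast
  \<comment> \<open>Composition keeps only the outer connections, \<open>lconn\<close> of
    \<open>U\<close> and \<open>rconn\<close> of \<open>V\<close>, which is why exactly
    \<open>left_ports\<close> and \<open>right_ports\<close> appear.\<close>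
  have ports: "trans_ports N (g (U, V)) = (\<Union>u\<in>U. ?L u) \<union> (\<Union>v\<in>V. ?R v)"
    if "minimal_synchronisation Nl Nr U V" for U V
  proof -
    have "(U, V) \<in> transitions (compose Nl Nr)" using that by (simp add: compose_def)
    then have "preset N (g (U, V)) = f ` preset (compose Nl Nr) (U, V)"
      "postset N (g (U, V)) = f ` postset (compose Nl Nr) (U, V)"
      "lconn N (g (U, V)) = lconn (compose Nl Nr) (U, V)"
      "rconn N (g (U, V)) = rconn (compose Nl Nr) (U, V)"
      using iso by blast+
    then show ?thesis
      unfolding trans_ports_def image_left_ports image_right_ports
      by (simp add: compose_def image_Plus image_Un image_UN UN_Un_distrib image_comp Un_ac)
  qed
  have L_sub: "?L u \<subseteq> ?EL" if "u \<in> transitions Nl" for u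
  proof -
    have "preset Nl u \<subseteq> places Nl" "postset Nl u \<subseteq> places Nl" "lconn Nl u \<subseteq> {..<k}"
      using assms(2) that unfolding boundary_net_def by blast+
    then show ?thesis
      unfolding image_left_ports eports_left_def place_ports_def assms(8) size
      by (intro Un_least) auto
  qed
  have R_sub: "?R v \<subseteq> ?ER" if "v \<in> transitions Nr" for v
  proof -
    have "preset Nr v \<subseteq> places Nr" "postset Nr v \<subseteq> places Nr" "rconn Nr v \<subseteq> {..<l}"
      using assms(3) that unfolding boundary_net_def by blast+
    then show ?thesis
      unfolding image_right_ports eports_right_def place_ports_def assms(9) size
      by (intro Un_least) auto
  qed
  have cross: "\<exists>u \<in> transitions Nl. \<exists>v \<in> transitions Nr. \<exists>j. j \<in> rconn Nl u \<and> j \<in> lconn Nr v \<and>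
      trans_ports N t \<inter> ?EL = ?L u \<and> trans_ports N t \<inter> ?ER = ?R v"
    if t: "t \<in> transitions N" and ne: "trans_ports N t \<inter> ?EL \<noteq> {}" "trans_ports N t \<inter> ?ER \<noteq> {}"
    for t
  proof -
    obtain U V where UV: "t = g (U, V)" and min: "minimal_synchronisation Nl Nr U V"
      using t trans_N by auto
    then have sub: "U \<subseteq> transitions Nl" "V \<subseteq> transitions Nr"
      by (auto simp: minimal_synchronisation_def synchronisation_def)
    have "(\<Union>u\<in>U. ?L u) \<subseteq> ?EL" using L_sub sub by blast
    moreover have "(\<Union>v\<in>V. ?R v) \<subseteq> ?ER" using R_sub sub by blast
    ultimately have P: "trans_ports N t \<inter> ?EL = (\<Union>u\<in>U. ?L u)" "trans_ports N t \<inter> ?ER = (\<Union>v\<in>V. ?R v)"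
      unfolding UV ports[OF min] by (rule split[THEN conjunct1], rule split[THEN conjunct2])
    \<comment> \<open>An empty component would contribute no port to its side, although
      \<open>t\<close> meets both sides.\<close>
    then have "U \<noteq> {}" "V \<noteq> {}" using ne by auto
    with unl unr min obtain u v j where "U = {u}" "V = {v}" "u \<in> transitions Nl"
      "v \<in> transitions Nr" "rconn Nl u = {j}" "lconn Nr v = {j}"
      by (rule minimal_synchronisation_cases)
    then show ?thesis using P by (intro bexI exI[of _ j]) simp_all
  qed
  have pair: "\<exists>t \<in> transitions N. trans_ports N t \<inter> ?EL = ?L u \<and> trans_ports N t \<inter> ?ER = ?R v"
    if uv: "u \<in> transitions Nl" "v \<in> transitions Nr" "j \<in> rconn Nl u" "j \<in> lconn Nr v" for u v j
  proof -
    have "rconn Nl u = {j}" "lconn Nr v = {j}"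
      using unl[OF uv(1)] unr[OF uv(2)] uv(3,4) by blast+
    then have min: "minimal_synchronisation Nl Nr {u} {v}"
      using minimal_synchronisation_pair uv(1,2) by metis
    have "g ({u}, {v}) \<in> transitions N" using trans_N min by auto
    moreover have "trans_ports N (g ({u}, {v})) = ?L u \<union> ?R v" using ports[OF min] by simp
    ultimately show ?thesis using split[OF L_sub[OF uv(1)] R_sub[OF uv(2)]] by metis
  qed
  have bound_l: "rconn Nl u \<subseteq> {..<n}" if "u \<in> transitions Nl" for u
    using assms(2) that unfolding boundary_net_def by blast
  have bound_r: "lconn Nr v \<subseteq> {..<n}" if "v \<in> transitions Nr" for v
    using assms(3) that unfolding boundary_net_def by blast
  \<comment> \<open>Renaming preserves emptiness, so the non-emptiness condition carries over and
    the vector takes the form required by \<open>is_basis_conn_on\<close>.\<close>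
  have bl: "image (map_port ?hl) ` bconn_left Nl j =
      {?L u | u. u \<in> transitions Nl \<and> j \<in> rconn Nl u \<and> ?L u \<noteq> {}}" for j
    by (subst bconn_left_eq) (blast dest: unl, auto)
  have br: "image (map_port ?hr) ` bconn_right Nr j =
      {?R v | v. v \<in> transitions Nr \<and> j \<in> lconn Nr v \<and> ?R v \<noteq> {}}" for j
    by (subst bconn_right_eq) (blast dest: unr, auto)
  have "is_basis n (\<lambda>i. image (map_port ?hr) ` bconn_right Nr i) (network_left N Pl Pr)"
    unfolding network_left_def br
    by (rule is_basis_conn_on[where X = "transitions Nl" and L = ?L, OF disj cross pair bound_l])
  moreover have "is_basis n (\<lambda>i. image (map_port ?hl) ` bconn_left Nl i) (network_right N Pl Pr)"
    unfolding network_right_def bl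
  \<comment> \<open>The mirror instance: near and far side are exchanged, so \<open>cross\<close>
    and \<open>pair\<close> are reused with their conjuncts swapped.\<close>
  proof (rule is_basis_conn_on[where X = "transitions Nr" and L = ?R and \<alpha> = "lconn Nr"])
    show "?ER \<inter> ?EL = {}" using disj by (simp add: Int_commute)
  next
    fix t assume "t \<in> transitions N" "trans_ports N t \<inter> ?ER \<noteq> {}" "trans_ports N t \<inter> ?EL \<noteq> {}"
    then show "\<exists>v \<in> transitions Nr. \<exists>u \<in> transitions Nl. \<exists>j. j \<in> lconn Nr v \<and> j \<in> rconn Nl u \<and>
        trans_ports N t \<inter> ?ER = ?R v \<and> trans_ports N t \<inter> ?EL = ?L u"
      using cross[of t] by metis
  next
    fix v u j assume "v \<in> transitions Nr" "u \<in> transitions Nl" "j \<in> lconn Nr v" "j \<in> rconn Nl u"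
    then show "\<exists>t \<in> transitions N. trans_ports N t \<inter> ?ER = ?R v \<and> trans_ports N t \<inter> ?EL = ?L u"
      using pair[of u v j] by metis
  qed (rule bound_r)
  ultimately show ?thesis using part by blast
qed

end
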